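(* Let $q$ be a prime power and $n\geq \ell\geq 0$ integers. Let $\mathcal F\subseteq \mathbb F_q[x]$ be a family of monic polynomials of degree $n$ that is $\ell$-intersecting (every two members have a greatest common divisor of degree at least $\ell$) and has the maximum possible size $q^{n-\ell}$. Suppose $\mathcal F$ is primary, i.e. no non-unit polynomial divides every element of $\mathcal F$, and non-trivial, i.e. $\mathcal F$ is not the family of all monic degree-$n$ multiples of a fixed monic polynomial $g$ of degree $\ell$. Then either $\mathcal F$ is the exceptional family with $q=2$, $\ell=1$, $n=3$, \[ \mathcal F=\{x^2(x+1),~ x(x+1)^2,~ x(x^2+x+1),~ (x+1)(x^2+x+1)\}\subseteq \mathbb F_2[x], \] or, with $d=n-\ell>0$ and $H_d$ the monic least common multiple of all degree $d$ polynomials over $\mathbb F_q$, \[ \mathcal F=\mathcal F_d:=\left\{ \frac{H_d}{p}: p \text{ is a monic polynomial over } \mathbb F_q,\ \deg(p)=d\right\}. \]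
   Context: Families of monic polynomials in $\mathbb F_q[x]$ of fixed degree $n$; $\ell$-intersecting means pairwise gcd of degree at least $\ell$; the maximum size of such a family is $q^{n-\ell}$ (extremal families are those attaining it). The family $\mathcal F_d$ is a $(\deg(H_d)-2d)$-intersecting family of degree $\deg(H_d)-d$ monic polynomials of size $q^d$. *)

theory Defs
  imports
    "HOL-Computational_Algebra.Polynomial_Factorial"
    "HOL-Library.Cardinality"
begin

(* The finite field F_q is a type of sort {field_gcd, finite}. The class field_gcd, which the
   library needs for gcd and Lcm on polynomials, is no restriction on the field: on every field
   its additional operations (normalize x = 1 and unit_factor x = x for x \<noteq> 0, trivial div, mod,
   gcd and lcm) exist, as in HOL-Computational_Algebra.Field_as_Ring. On polynomials gcd and Lcm
   are normalized, so that they are monic whenever they are nonzero. *)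

definition monic_polys :: "nat \<Rightarrow> 'a::field_gcd poly set" where
  "monic_polys n = {f. lead_coeff f = 1 \<and> degree f = n}"

definition intersecting :: "nat \<Rightarrow> 'a::field_gcd poly set \<Rightarrow> bool" where
  "intersecting l F \<longleftrightarrow> (\<forall>f\<in>F. \<forall>g\<in>F. l \<le> degree (gcd f g))"

definition primary :: "'a::field_gcd poly set \<Rightarrow> bool" where
  "primary F \<longleftrightarrow> \<not> (\<exists>p. \<not> is_unit p \<and> (\<forall>f\<in>F. p dvd f))"

definition trivial_family :: "nat \<Rightarrow> nat \<Rightarrow> 'a::field_gcd poly set \<Rightarrow> bool" where
  "trivial_family n l F \<longleftrightarrow> (\<exists>g\<in>monic_polys l. F = {f \<in> monic_polys n. g dvd f})"

(* The zero polynomial has degree 0 in the library and has to be excluded when d = 0. *)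
definition H_poly :: "nat \<Rightarrow> 'a::field_gcd poly" where
  "H_poly d = Lcm {p. p \<noteq> 0 \<and> degree p = d}"

definition F_family :: "nat \<Rightarrow> 'a::field_gcd poly set" where
  "F_family d = {H_poly d div p | p. p \<in> monic_polys d}"

definition exceptional_family :: "'a::field_gcd poly set" where
  "exceptional_family =
     (let x = [:0, 1:]
      in {x ^ 2 * (x + 1), x * (x + 1) ^ 2, x * (x ^ 2 + x + 1), (x + 1) * (x ^ 2 + x + 1)})"

end

(* Put d = n - l and let m be a monic irreducible polynomial of degree d; it exists because the
   von Mangoldt function sums to q^i over the monic polynomials of degree i. If f, g in F have
   different multiplicities at m, then their coprime cofactors have degree at most d and one of
   them is divisible by m, so it equals m. Hence at most two, consecutive, multiplicities occur,
   and a residue count modulo m shows that two do occur. Let F be the disjoint union of A (lower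
   multiplicity) and B accordingly: f m = g b with b monic of degree d for all f in A, g in B.
   Consequently there are a monic K and t <= d such that f m is K times a monic polynomial of
   degree d - t for f in A, and K is g times a monic polynomial of degree t for g in B. So
   q^d = |A| + |B| <= q^(d-t) + q^t, which forces t = 0 (F is trivial), t = d (F consists of the
   quotients of K by all monic polynomials of degree d, and K = H_d by primarity), or q = d = 2
   and t = 1. *)

theory Submission
  imports Defs
begin

section \<open>Monic polynomials\<close>

lemma monic_polysI: "lead_coeff f = 1 \<Longrightarrow> degree f = n \<Longrightarrow> f \<in> monic_polys n"
  by (simp add: monic_polys_def)

lemma monic_polysD:
  assumes "f \<in> monic_polys n"
  shows "lead_coeff f = 1" "degree f = n" "f \<noteq> 0"
  using assms by (auto simp: monic_polys_def)

lemma monic_polys_mult: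
  "f \<in> monic_polys m \<Longrightarrow> g \<in> monic_polys n \<Longrightarrow> f * g \<in> monic_polys (m + n)"
  by (rule monic_polysI, simp add: lead_coeff_mult monic_polysD(1))
    (simp add: degree_mult_eq monic_polysD)

lemma monic_polys_factor:
  assumes "f * g \<in> monic_polys n" "f \<in> monic_polys m"
  shows "m \<le> n" "g \<in> monic_polys (n - m)"
proof -
  have "g \<noteq> 0" using monic_polysD(3)[OF assms(1)] by auto
  then have "degree (f * g) = m + degree g"
    using monic_polysD[OF assms(2)] by (simp add: degree_mult_eq)
  moreover have "lead_coeff g = 1"
    using monic_polysD(1)[OF assms(1)] monic_polysD(1)[OF assms(2)] by (simp add: lead_coeff_mult)
  ultimately show "m \<le> n" "g \<in> monic_polys (n - m)"
    using monic_polysD(2)[OF assms(1)] by (auto intro: monic_polysI)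
qed

lemma monic_polys_0: "monic_polys 0 = {1}"
proof -
  have "f = 1" if "f \<in> monic_polys 0" for f :: "'a poly"
    using monic_polysD[OF that] by (metis degree_0_id one_pCons)
  then show ?thesis by (auto intro: monic_polysI)
qed

lemma degree_normalize:
  fixes f :: "'a::field_gcd poly"
  shows "degree (normalize f) = degree f"
  by (cases "f = 0") (auto intro!: le_antisym dvd_imp_degree_le)

text \<open>Every nonzero field element has \<open>normalize\<close> equal to 1 and so is its own
  \<open>unit_factor\<close>; hence nonzero normalized polynomials, such as gcds, Lcms and primes,
  are monic.\<close>

lemma monic_polys_normalize:
  fixes f :: "'a::field_gcd poly"
  assumes "normalize f = f" "f \<noteq> 0"
  shows "f \<in> monic_polys (degree f)"
proof -
  have "unit_factor f = 1" using assms unit_factor_normalize by metis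
  then have "unit_factor (lead_coeff f) = 1"
    by (simp add: unit_factor_poly_def one_pCons)
  moreover have "normalize (lead_coeff f) = 1"
    using assms by (simp add: is_unit_normalize dvd_field_iff)
  ultimately have "lead_coeff f = 1"
    using unit_factor_mult_normalize[of "lead_coeff f"] by simp
  then show ?thesis by (simp add: monic_polysI)
qed

section \<open>Counting monic polynomials and residues\<close>

lemma monic_polys_Suc:
  "monic_polys (Suc n) = (\<lambda>(c, f). pCons c f) ` (UNIV \<times> monic_polys n)"
proof (intro equalityI subsetI)
  fix f :: "'a poly" assume f: "f \<in> monic_polys (Suc n)"
  obtain c g where fg: "f = pCons c g" by (cases f)
  then have "g \<in> monic_polys n"
    using f by (auto simp: monic_polys_def split: if_splits)
  then show "f \<in> (\<lambda>(c, f). pCons c f) ` (UNIV \<times> monic_polys n)" using fg by auto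
qed (auto simp: monic_polys_def)

lemma monic_polys_1: "monic_polys 1 = range (\<lambda>c. [:c, 1:])"
  using monic_polys_Suc[of 0] by (auto simp: monic_polys_0 image_def one_pCons)

lemma finite_card_monic_polys:
  "finite (monic_polys n :: 'a::{field_gcd, finite} poly set) \<and>
   card (monic_polys n :: 'a poly set) = CARD('a) ^ n"
proof (induction n)
  case 0
  show ?case by (simp add: monic_polys_0)
next
  case (Suc n)
  have "inj_on (\<lambda>(c, f). pCons c f) (UNIV \<times> monic_polys n :: ('a \<times> 'a poly) set)"
    by (auto simp: inj_on_def)
  then show ?case using Suc unfolding monic_polys_Suc by (simp add: card_image card_cartesian_product)
qed

lemmas finite_monic_polys [simp] = finite_card_monic_polys[THEN conjunct1]
lemmas card_monic_polys = finite_card_monic_polys[THEN conjunct2]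

lemma card_monic_multiples:
  fixes e :: "'a::{field_gcd, finite} poly"
  assumes "e \<in> monic_polys i" "i \<le> n"
  shows "card {f \<in> monic_polys n. e dvd f} = CARD('a) ^ (n - i)"
proof -
  have "{f \<in> monic_polys n. e dvd f} = (*) e ` monic_polys (n - i)"
    using monic_polys_factor(2)[OF _ assms(1)] monic_polys_mult[OF assms(1), of _ "n - i"] assms(2)
    by (auto elim!: dvdE)
  moreover have "inj_on ((*) e) (monic_polys (n - i))"
    using monic_polysD(3)[OF assms(1)] by (auto simp: inj_on_def)
  ultimately show ?thesis by (simp add: card_image card_monic_polys)
qed

text \<open>Adding x^d maps these residues injectively into the monic polynomials of degree
  \<open>d\<close>. The disjunct \<open>p = 0\<close> keeps the residue 0 when \<open>d\<close> is
  0, since the zero polynomial has degree 0.\<close>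

lemma card_degree_less:
  "finite {p :: 'a::{field_gcd, finite} poly. p = 0 \<or> degree p < d} \<and>
   card {p :: 'a poly. p = 0 \<or> degree p < d} \<le> CARD('a) ^ d" (is "finite ?S \<and> _")
proof -
  have inj: "inj_on ((+) (monom 1 d)) ?S" by (simp add: inj_on_def)
  have "monom 1 d + p \<in> monic_polys d" if p: "p \<in> ?S" for p
  proof (cases "p = 0")
    case True
    then show ?thesis by (auto intro!: monic_polysI simp: degree_monom_eq)
  next
    case False
    then have "degree p < degree (monom (1::'a) d)" using p by (simp add: degree_monom_eq)
    then have "degree (monom 1 d + p) = d" "coeff p d = 0"
      by (simp_all add: degree_add_eq_left degree_monom_eq coeff_eq_0)
    then show ?thesis by (auto intro: monic_polysI)
  qed
  then have sub: "(+) (monom 1 d) ` ?S \<subseteq> monic_polys d" by auto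
  show ?thesis
    using inj_on_finite[OF inj sub] card_inj_on_le[OF inj sub] by (simp add: card_monic_polys)
qed

section \<open>Irreducible polynomials of every degree\<close>

lemma prime_monic_polys:
  fixes p :: "'a::field_gcd poly"
  assumes "prime p"
  shows "p \<in> monic_polys (degree p)" "degree p > 0"
proof -
  have "p \<noteq> 0" "normalize p = p" "\<not> is_unit p" using assms by (auto simp: prime_def)
  then show "p \<in> monic_polys (degree p)" "degree p > 0"
    using monic_polys_normalize is_unit_iff_degree by blast+
qed

section \<open>The von Mangoldt function on polynomials\<close>

lemma degree_eq_sum_prime_factors:
  fixes f :: "'a::field_gcd poly"
  assumes "f \<noteq> 0"
  shows "degree f = (\<Sum>p\<in>prime_factors f. multiplicity p f * degree p)"
proof -
  have nz: "p \<noteq> 0" if "p \<in> prime_factors f" for p using that by (auto simp: in_prime_factors_iff)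
  have "degree f = degree (normalize f)" by (simp add: degree_normalize)
  also have "normalize f = (\<Prod>p\<in>prime_factors f. p ^ multiplicity p f)"
    using assms by (simp add: prod_prime_factors)
  also have "degree \<dots> = (\<Sum>p\<in>prime_factors f. degree (p ^ multiplicity p f))"
    using nz by (intro degree_prod_eq_sum_degree) auto
  also have "\<dots> = (\<Sum>p\<in>prime_factors f. multiplicity p f * degree p)"
    by (intro sum.cong refl) (simp add: nz degree_power_eq)
  finally show ?thesis .
qed

text \<open>The support of the von Mangoldt function in degree \<open>n\<close>:
  \<open>prime\<close> includes being normalized, so a pair stands for the monic prime power
  \<open>p ^ j\<close>, whose weight is \<open>degree p\<close>.\<close>

definition prime_powers_of_degree :: "nat \<Rightarrow> ('a::field_gcd poly \<times> nat) set" where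
  "prime_powers_of_degree n = {(p, j). prime p \<and> 0 < j \<and> j * degree p = n}"

lemma finite_primes_degree_le: "finite {p :: 'a::{field_gcd, finite} poly. prime p \<and> degree p \<le> n}"
proof (rule finite_subset)
  show "{p :: 'a poly. prime p \<and> degree p \<le> n} \<subseteq> (\<Union>i\<le>n. monic_polys i)"
    using prime_monic_polys(1) by blast
qed auto

lemma prime_powers_of_degree_bounds:
  assumes "(p, j) \<in> prime_powers_of_degree n"
  shows "prime p" "0 < j" "j * degree p = n" "degree p \<le> n" "j \<le> n" "0 < degree p"
proof -
  show *: "prime p" "0 < j" "j * degree p = n"
    using assms by (auto simp: prime_powers_of_degree_def)
  then show "degree p \<le> n" "j \<le> n" "0 < degree p"
    using prime_monic_polys(2)[of p] by auto
qed

lemma finite_prime_powers_of_degree [simp]: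
  "finite (prime_powers_of_degree n :: ('a::{field_gcd, finite} poly \<times> nat) set)"
proof (rule finite_subset)
  show "(prime_powers_of_degree n :: ('a poly \<times> nat) set) \<subseteq> {p. prime p \<and> degree p \<le> n} \<times> {..n}"
    by (auto dest: prime_powers_of_degree_bounds)
qed (simp add: finite_primes_degree_le)

text \<open>The sum of the von Mangoldt function over the monic polynomials of degree n.\<close>

definition mangoldt_sum :: "'a::field_gcd itself \<Rightarrow> nat \<Rightarrow> nat" where
  "mangoldt_sum _ n = (\<Sum>(p :: 'a poly, j)\<in>prime_powers_of_degree n. degree p)"

text \<open>The analogue of log n being the sum of Lambda over the divisors of n: a prime
  \<open>p\<close> of multiplicity v in \<open>f\<close> contributes \<open>degree p\<close> once
  for each of its powers up to the v-th, and these powers are then grouped by their degree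
  \<open>i\<close>.\<close>

lemma degree_eq_sum_prime_powers:
  fixes f :: "'a::{field_gcd, finite} poly"
  assumes "f \<in> monic_polys n"
  shows "n = (\<Sum>i=1..n. \<Sum>(p, j)\<in>prime_powers_of_degree i. if p ^ j dvd f then degree p else 0)"
proof -
  have f0: "f \<noteq> 0" and deg: "degree f = n" using monic_polysD[OF assms] by auto
  define S where "S = (SIGMA p : prime_factors f. {1..multiplicity p f})"
  have fin: "finite S" by (simp add: S_def)
  have S_iff: "(p, j) \<in> S \<longleftrightarrow> prime p \<and> 0 < j \<and> p ^ j dvd f" for p j
  proof
    assume "(p, j) \<in> S"
    then show "prime p \<and> 0 < j \<and> p ^ j dvd f"
      by (auto simp: S_def in_prime_factors_iff intro: multiplicity_dvd')
  next
    assume *: "prime p \<and> 0 < j \<and> p ^ j dvd f"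
    then have "p dvd f" using dvd_power[of j p] dvd_trans by blast
    moreover have "j \<le> multiplicity p f"
      using * f0 by (intro multiplicity_geI) auto
    ultimately show "(p, j) \<in> S" using * f0 by (auto simp: S_def in_prime_factors_iff)
  qed
  have le: "j * degree p \<in> {1..n}" if "(p, j) \<in> S" for p j
  proof -
    have *: "prime p" "0 < j" "p ^ j dvd f" using that S_iff by auto
    then have "degree (p ^ j) \<le> n" using dvd_imp_degree_le f0 deg by blast
    moreover have "degree (p ^ j) = j * degree p"
      using * by (intro degree_power_eq) auto
    ultimately show ?thesis using prime_monic_polys(2)[OF *(1)] * by auto
  qed
  have "n = (\<Sum>p\<in>prime_factors f. \<Sum>j\<in>{1..multiplicity p f}. degree p)"
    using degree_eq_sum_prime_factors[OF f0] deg by simp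
  also have "\<dots> = (\<Sum>(p, j)\<in>S. degree p)"
    unfolding S_def by (subst sum.Sigma) auto
  also have "\<dots> = (\<Sum>i\<in>{1..n}. \<Sum>(p, j)\<in>{x \<in> S. (\<lambda>(p, j). j * degree p) x = i}. degree p)"
    using le fin by (intro sum.group[symmetric]) auto
  also have "\<dots> = (\<Sum>i=1..n. \<Sum>(p, j)\<in>prime_powers_of_degree i. if p ^ j dvd f then degree p else 0)"
  proof (rule sum.cong[OF refl])
    fix i
    have "{x \<in> S. (\<lambda>(p, j). j * degree p) x = i} = {(p, j) \<in> prime_powers_of_degree i. p ^ j dvd f}"
      by (auto simp: S_iff prime_powers_of_degree_def)
    then show "(\<Sum>(p, j)\<in>{x \<in> S. (\<lambda>(p, j). j * degree p) x = i}. degree p) =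
      (\<Sum>(p, j)\<in>prime_powers_of_degree i. if p ^ j dvd f then degree p else 0)"
      by (auto simp: sum.inter_filter[symmetric] case_prod_unfold intro!: sum.cong)
  qed
  finally show ?thesis .
qed

text \<open>Sum the previous identity over all monic \<open>f\<close> of degree \<open>n\<close> and
  exchange the sums: a prime power of degree \<open>i\<close> divides exactly q^(n-i) of
  them.\<close>

lemma mangoldt_sum_convolution:
  "n * CARD('a) ^ n =
    (\<Sum>i=1..n. mangoldt_sum TYPE('a::{field_gcd, finite}) i * CARD('a) ^ (n - i))"
proof -
  have "n * CARD('a) ^ n = (\<Sum>f\<in>(monic_polys n :: 'a poly set). n)"
    by (simp add: card_monic_polys)
  also have "\<dots> = (\<Sum>f\<in>(monic_polys n :: 'a poly set).
      \<Sum>i=1..n. \<Sum>(p, j)\<in>prime_powers_of_degree i. if p ^ j dvd f then degree p else 0)"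
    using degree_eq_sum_prime_powers by (intro sum.cong refl) blast
  also have "\<dots> = (\<Sum>i=1..n. \<Sum>f\<in>(monic_polys n :: 'a poly set).
      \<Sum>(p, j)\<in>prime_powers_of_degree i. if p ^ j dvd f then degree p else 0)"
    by (rule sum.swap)
  also have "\<dots> = (\<Sum>i=1..n. mangoldt_sum TYPE('a) i * CARD('a) ^ (n - i))"
  proof (rule sum.cong[OF refl])
    fix i assume i: "i \<in> {1..n}"
    have "(\<Sum>f\<in>monic_polys n. if p ^ j dvd f then degree p else 0) = degree p * CARD('a) ^ (n - i)"
      if pj: "(p, j) \<in> prime_powers_of_degree i" for p :: "'a poly" and j
    proof -
      note b = prime_powers_of_degree_bounds[OF pj]
      have "lead_coeff (p ^ j) = 1"
        using monic_polysD(1)[OF prime_monic_polys(1)[OF b(1)]] by (simp add: lead_coeff_power)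
      moreover have "degree (p ^ j) = i"
        using b by (subst degree_power_eq) auto
      ultimately have "p ^ j \<in> monic_polys i" by (rule monic_polysI)
      then have "card {f \<in> monic_polys n. p ^ j dvd f} = CARD('a) ^ (n - i)"
        using i by (intro card_monic_multiples) auto
      then show ?thesis by (simp add: sum.inter_filter[symmetric])
    qed
    then show "(\<Sum>f\<in>(monic_polys n :: 'a poly set).
        \<Sum>(p, j)\<in>prime_powers_of_degree i. if p ^ j dvd f then degree p else 0) =
      mangoldt_sum TYPE('a) i * CARD('a) ^ (n - i)"
      unfolding mangoldt_sum_def
      by (subst sum.swap) (auto simp: sum_distrib_right case_prod_unfold intro!: sum.cong)
  qed
  finally show ?thesis .
qed

text \<open>Subtracting q times the convolution for \<open>n\<close> from the one for
  \<open>Suc n\<close> leaves a single term, equal to (n+1) q^(n+1) - n q^(n+1). Degree 0 is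
  excluded because the sum is empty there.\<close>

lemma mangoldt_sum_eq: "mangoldt_sum TYPE('a::{field_gcd, finite}) (Suc n) = CARD('a) ^ Suc n"
proof -
  let ?q = "CARD('a)" and ?\<psi> = "mangoldt_sum TYPE('a)"
  have "Suc n * ?q ^ Suc n = (\<Sum>i=1..n. ?\<psi> i * ?q ^ (Suc n - i)) + ?\<psi> (Suc n)"
    by (subst mangoldt_sum_convolution) simp
  also have "(\<Sum>i=1..n. ?\<psi> i * ?q ^ (Suc n - i)) = ?q * (\<Sum>i=1..n. ?\<psi> i * ?q ^ (n - i))"
    by (auto simp: sum_distrib_left Suc_diff_le intro!: sum.cong)
  also have "(\<Sum>i=1..n. ?\<psi> i * ?q ^ (n - i)) = n * ?q ^ n"
    by (rule mangoldt_sum_convolution[symmetric])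
  finally show ?thesis by simp
qed

section \<open>Existence of primes in every positive degree\<close>

lemma sum_power_less:
  fixes q :: nat
  assumes "2 \<le> q"
  shows "(\<Sum>k<n. q ^ k) < q ^ n"
proof (induction n)
  case (Suc n)
  have "2 * q ^ n \<le> q * q ^ n" using assms by simp
  then have "(\<Sum>k<n. q ^ k) + q ^ n < q * q ^ n" using Suc by linarith
  then show ?case by simp
qed simp

lemma CARD_field_ge_2: "2 \<le> CARD('a::{field_gcd, finite})"
  using card_mono[of "UNIV :: 'a set" "{0, 1}"] by simp

text \<open>Without a prime of degree \<open>d\<close>, the whole von Mangoldt sum q^d would come
  from primes of smaller degree. Those of degree k contribute at most q^k, and 1 + q + ... + q^(d-1)
  < q^d.\<close>

lemma exists_prime_of_degree:
  assumes "0 < d"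
  shows "\<exists>m :: 'a::{field_gcd, finite} poly. prime m \<and> degree m = d"
proof (rule ccontr)
  assume none: "\<not> ?thesis"
  let ?\<psi> = "mangoldt_sum TYPE('a)"
  let ?X = "prime_powers_of_degree :: nat \<Rightarrow> ('a poly \<times> nat) set"
  define P where "P = {p :: 'a poly. prime p \<and> degree p < d}"
  have fin: "finite P" unfolding P_def
    by (rule finite_subset[OF _ finite_primes_degree_le[of d]]) auto
  \<comment> \<open>The exponent \<open>j\<close> is determined by \<open>p\<close>, since
    \<open>degree p\<close> is positive.\<close>
  have inj: "inj_on fst (?X d)"
  proof (rule inj_onI)
    fix x y assume "x \<in> ?X d" "y \<in> ?X d" "fst x = fst y"
    then show "x = y"
      using prime_powers_of_degree_bounds[of "fst x" "snd x" d]
        prime_powers_of_degree_bounds[of "fst y" "snd y" d]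
      by (metis mult_cancel2 not_less0 prod.collapse)
  qed
  have "?\<psi> d = (\<Sum>p\<in>fst ` ?X d. degree p)"
    using inj by (simp add: mangoldt_sum_def sum.reindex case_prod_unfold)
  also have "\<dots> \<le> (\<Sum>p\<in>P. degree p)"
  proof (rule sum_mono2[OF fin])
    have "p \<in> P" if "(p, j) \<in> ?X d" for p j
      using none prime_powers_of_degree_bounds(1,4)[OF that] unfolding P_def le_less by blast
    then show "fst ` ?X d \<subseteq> P" by auto
  qed simp
  also have "\<dots> = (\<Sum>k<d. \<Sum>p\<in>{p \<in> P. degree p = k}. degree p)"
    using fin by (intro sum.group[symmetric]) (auto simp: P_def)
  also have "\<dots> \<le> (\<Sum>k<d. CARD('a) ^ k)"
  proof (rule sum_mono)
    fix k assume "k \<in> {..<d}"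
    show "(\<Sum>p\<in>{p \<in> P. degree p = k}. degree p) \<le> CARD('a) ^ k"
    proof (cases k)
      case (Suc i)
      \<comment> \<open>The primes of degree \<open>k\<close> are the pairs with exponent 1 in the
        von Mangoldt sum of degree \<open>k\<close>.\<close>
      have "(\<Sum>p\<in>{p \<in> P. degree p = k}. degree p) =
          (\<Sum>(p, j)\<in>(\<lambda>p. (p, 1 :: nat)) ` {p \<in> P. degree p = k}. degree p)"
        by (subst sum.reindex) (auto simp: inj_on_def)
      also have "\<dots> \<le> ?\<psi> k" unfolding mangoldt_sum_def
        by (rule sum_mono2[OF finite_prime_powers_of_degree])
          (auto simp: P_def prime_powers_of_degree_def)
      finally show ?thesis using mangoldt_sum_eq[where 'a = 'a, of i] Suc by simp
    qed simp
  qed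
  also have "\<dots> < CARD('a) ^ d" by (rule sum_power_less[OF CARD_field_ge_2])
  finally show False
    using mangoldt_sum_eq[where 'a = 'a, of "d - 1"] assms by simp
qed

section \<open>Extremal intersecting families\<close>

lemma gcd_monic_polys_decompose:
  fixes f g :: "'a::field_gcd poly"
  assumes "f \<in> monic_polys n" "g \<in> monic_polys n" "l \<le> degree (gcd f g)"
  obtains e a b k where "l \<le> k" "k \<le> n" "e \<in> monic_polys k" "a \<in> monic_polys (n - k)"
    "b \<in> monic_polys (n - k)" "coprime a b" "f = e * a" "g = e * b"
proof -
  have f0: "f \<noteq> 0" using assms(1) by (rule monic_polysD)
  define e where "e = gcd f g"
  have e: "e \<in> monic_polys (degree e)"
    using f0 by (intro monic_polys_normalize) (auto simp: e_def)
  have "e \<noteq> 0" using f0 by (simp add: e_def)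
  then obtain a b where "f = a * e" "g = b * e" "coprime a b"
    using gcd_coprime_exists[of f g] unfolding e_def by blast
  then have ab: "f = e * a" "g = e * b" "coprime a b" by (simp_all add: mult.commute)
  have "e * a \<in> monic_polys n" "e * b \<in> monic_polys n" using assms(1,2) ab by simp_all
  then show ?thesis
    using that[OF _ _ e _ _ ab(3,1,2)] monic_polys_factor[OF _ e] assms(3) e_def by blast
qed

text \<open>The coprime cofactors have degree at most \<open>n - l\<close>, the degree of
  \<open>m\<close>. That of \<open>g\<close> has the higher multiplicity at \<open>m\<close>, so
  \<open>m\<close> divides it and no room is left: it equals \<open>m\<close>, and the gcd has
  degree exactly \<open>l\<close>.\<close>

lemma prime_multiplicity_less_decompose:
  fixes m :: "'a::field_gcd poly"
  assumes m: "prime m" "degree m = n - l" and "l \<le> n"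
    and fg: "f \<in> monic_polys n" "g \<in> monic_polys n" "l \<le> degree (gcd f g)"
    and less: "multiplicity m f < multiplicity m g"
  obtains e b where "e \<in> monic_polys l" "b \<in> monic_polys (n - l)" "\<not> m dvd b"
    "f = e * b" "g = e * m"
proof -
  obtain e a b k where k: "l \<le> k" "k \<le> n" and e: "e \<in> monic_polys k"
    and ab: "a \<in> monic_polys (n - k)" "b \<in> monic_polys (n - k)" "coprime a b"
    and eq: "f = e * a" "g = e * b"
    using gcd_monic_polys_decompose[OF fg] .
  note nz = monic_polysD(3)[OF e] monic_polysD(3)[OF ab(1)] monic_polysD(3)[OF ab(2)]
  have mm: "m \<in> monic_polys (n - l)" using prime_monic_polys(1)[OF m(1)] m(2) by simp
  have "prime_elem m" using m(1) by simp
  then have "multiplicity m a < multiplicity m b"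
    using less nz by (simp add: eq prime_elem_multiplicity_mult_distrib)
  then have "multiplicity m b > 0" by simp
  then have mb: "m dvd b"
    using not_dvd_imp_multiplicity_0 by fastforce
  then obtain c where c: "b = m * c" ..
  have kl: "k = l"
    using dvd_imp_degree_le[OF mb nz(3)] monic_polysD(2)[OF ab(2)] m(2) k by simp
  have "c \<in> monic_polys 0"
    using monic_polys_factor(2)[OF _ mm, of c "n - k"] ab(2) c kl by simp
  then have b: "b = m" using c by (simp add: monic_polys_0)
  have "\<not> m dvd a"
    using ab(3) b m(1) by (metis coprime_absorb_right not_prime_unit)
  \<comment> \<open>The cofactor \<open>a\<close> of \<open>f\<close> becomes the \<open>b\<close>
    of the conclusion.\<close>
  then show ?thesis using that[of e a] e ab(1) eq b kl by simp
qed

text \<open>Members of equal multiplicity at a prime of degree \<open>n - l\<close> are separated by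
  their unit part modulo that prime, and there are only \<open>q ^ (n - l) - 1\<close> nonzero residues.\<close>

lemma exists_multiplicity_less:
  fixes F :: "'a::{field_gcd, finite} poly set"
  assumes m: "prime m" "degree m = n - l"
    and F: "F \<subseteq> monic_polys n" "intersecting l F" "card F = CARD('a) ^ (n - l)"
  shows "\<exists>f\<in>F. \<exists>g\<in>F. multiplicity m f < multiplicity m g"
proof (rule ccontr)
  assume "\<not> ?thesis"
  then have same: "multiplicity m f = multiplicity m g" if "f \<in> F" "g \<in> F" for f g
    using that by (metis linorder_neqE_nat)
  have m0: "m \<noteq> 0" "\<not> is_unit m" and pm: "prime_elem m" using m(1) by auto
  have F0: "f \<noteq> 0" if "f \<in> F" for f using F(1) that monic_polysD(3) by blast
  have "\<exists>r. f = m ^ multiplicity m f * r \<and> \<not> m dvd r" if "f \<in> F" for f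
    using multiplicity_decompose'[OF F0[OF that] m0(2)] by metis
  then obtain r where r: "\<And>f. f \<in> F \<Longrightarrow> f = m ^ multiplicity m f * r f"
    "\<And>f. f \<in> F \<Longrightarrow> \<not> m dvd r f" by metis
  let ?R = "{p :: 'a poly. p = 0 \<or> degree p < n - l}"
  have "(\<lambda>f. r f mod m) ` F \<subseteq> ?R - {0}"
    using r(2) degree_mod_less[OF m0(1)] m(2) by (auto simp: dvd_eq_mod_eq_0)
  then have "card ((\<lambda>f. r f mod m) ` F) \<le> card (?R - {0})"
    using card_degree_less[where 'a = 'a] by (intro card_mono) auto
  also have "\<dots> < card ?R"
    using card_degree_less[where 'a = 'a, of "n - l"] by (intro psubset_card_mono) auto
  also have "\<dots> \<le> card F"
    using F(3) card_degree_less[where 'a = 'a, of "n - l"] by simp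
  finally have "\<not> inj_on (\<lambda>f. r f mod m) F" using card_image by fastforce
  then obtain f g where fg: "f \<in> F" "g \<in> F" "f \<noteq> g" "r f mod m = r g mod m"
    by (auto simp: inj_on_def)
  define v where "v = multiplicity m f"
  have v: "multiplicity m f = v" "multiplicity m g = v" using same[OF fg(1,2)] by (simp_all add: v_def)
  have "m dvd r f - r g" using fg(4) by (simp add: mod_eq_dvd_iff)
  then have "m ^ v * m dvd m ^ v * (r f - r g)" by simp
  also have "m ^ v * (r f - r g) = f - g"
    using r(1)[OF fg(1)] r(1)[OF fg(2)] v by (simp add: algebra_simps)
  finally have pow: "m ^ Suc v dvd f - g" by (simp add: mult.commute)
  \<comment> \<open>By \<open>pow\<close> the multiplicity of \<open>f - g\<close> exceeds
    \<open>v\<close>. Dividing out the gcd shows that it is exactly \<open>v\<close>: the cofactors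
    are prime to \<open>m\<close>, so \<open>e\<close> has multiplicity \<open>v\<close>, while
    \<open>a - b\<close> is nonzero of degree below that of \<open>m\<close>.\<close>
  have "f \<in> monic_polys n" "g \<in> monic_polys n" "l \<le> degree (gcd f g)"
    using F fg by (auto simp: intersecting_def)
  then obtain e a b k where k: "l \<le> k" "k \<le> n" and e: "e \<in> monic_polys k"
    and ab: "a \<in> monic_polys (n - k)" "b \<in> monic_polys (n - k)" "coprime a b"
    and eq: "f = e * a" "g = e * b"
    by (rule gcd_monic_polys_decompose)
  note nz = monic_polysD(3)[OF e] monic_polysD(3)[OF ab(1)] monic_polysD(3)[OF ab(2)]
  have ab0: "a - b \<noteq> 0" using eq fg(3) by auto
  have "multiplicity m a = multiplicity m b"
    using v nz pm by (simp add: eq prime_elem_multiplicity_mult_distrib)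
  moreover have "\<not> (m dvd a \<and> m dvd b)"
    using ab(3) m0(2) coprime_common_divisor by blast
  ultimately have "multiplicity m a = 0"
    using nz m0 by (metis multiplicity_eq_zero_iff)
  then have "multiplicity m e = v"
    using v nz pm by (simp add: eq prime_elem_multiplicity_mult_distrib)
  moreover have "\<not> m dvd a - b"
  proof
    assume "m dvd a - b"
    then have "n - l \<le> degree (a - b)" using dvd_imp_degree_le[OF _ ab0] m(2) by metis
    \<comment> \<open>The leading terms of two monic polynomials of equal degree cancel; in degree 0
      both would be 1, against \<open>ab0\<close>.\<close>
    moreover have "degree (a - b) < n - k"
    proof (cases "n - k")
      case 0
      then show ?thesis using ab ab0 by (simp add: monic_polys_0)
    next
      case (Suc i)
      have "degree (a - b) \<le> i"
      proof (rule degree_le, intro allI impI)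
        fix j assume "i < j"
        show "coeff (a - b) j = 0"
        proof (cases "j = n - k")
          case True
          then show ?thesis using monic_polysD(1,2)[OF ab(1)] monic_polysD(1,2)[OF ab(2)] by simp
        next
          case False
          then show ?thesis
            using \<open>i < j\<close> Suc monic_polysD(2)[OF ab(1)] monic_polysD(2)[OF ab(2)]
            by (simp add: coeff_eq_0)
        qed
      qed
      then show ?thesis using Suc by simp
    qed
    ultimately show False using k by simp
  qed
  then have "multiplicity m (a - b) = 0" by (rule not_dvd_imp_multiplicity_0)
  moreover have "f - g = e * (a - b)" by (simp add: eq algebra_simps)
  ultimately have "multiplicity m (f - g) = v"
    using nz ab0 pm by (simp add: prime_elem_multiplicity_mult_distrib)
  then show False
    using multiplicity_geI[OF _ m0(2) pow] fg(3) by auto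
qed

text \<open>The polynomial \<open>K\<close> is \<open>g * D\<close> for a fixed \<open>g \<in> B\<close>, where \<open>D\<close>
  is the gcd of the cofactors \<open>b\<close> in \<open>f * m = g * b\<close> for \<open>f \<in> A\<close>.\<close>

lemma common_multiple_of_bipartition:
  fixes A B :: "'a::field_gcd poly set"
  assumes A: "A \<subseteq> monic_polys n" "A \<noteq> {}" and B: "B \<subseteq> monic_polys n" "B \<noteq> {}"
    and cross: "\<forall>f\<in>A. \<forall>g\<in>B. \<exists>b\<in>monic_polys d. f * m = g * b"
  obtains K t where "t \<le> d" "K \<in> monic_polys (n + t)"
    "\<And>f. f \<in> A \<Longrightarrow> \<exists>u\<in>monic_polys (d - t). f * m = K * u"
    "\<And>g. g \<in> B \<Longrightarrow> \<exists>h\<in>monic_polys t. g * h = K"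
proof -
  obtain g0 where g0: "g0 \<in> B" using B by auto
  have "\<forall>f\<in>A. \<exists>b. b \<in> monic_polys d \<and> f * m = g0 * b" using cross g0 by blast
  from bchoice[OF this]
  obtain b where b: "\<And>f. f \<in> A \<Longrightarrow> b f \<in> monic_polys d" "\<And>f. f \<in> A \<Longrightarrow> f * m = g0 * b f"
    by blast
  obtain f0 where f0: "f0 \<in> A" using A by auto
  define D where "D = Gcd (b ` A)"
  define t where "t = degree D"
  have D_dvd: "D dvd b f" if "f \<in> A" for f unfolding D_def using that by (intro Gcd_dvd) auto
  have "D \<noteq> 0" using D_dvd[OF f0] monic_polysD(3)[OF b(1)[OF f0]] by auto
  then have D: "D \<in> monic_polys t"
    unfolding t_def by (intro monic_polys_normalize) (simp add: D_def)
  have K: "g0 * D \<in> monic_polys (n + t)"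
    using monic_polys_mult[OF _ D] B g0 by blast
  have cof: "t \<le> d \<and> (\<exists>u\<in>monic_polys (d - t). f * m = g0 * D * u)" if f: "f \<in> A" for f
  proof -
    obtain u where u: "b f = D * u" using D_dvd[OF f] ..
    then show ?thesis
      using monic_polys_factor[OF _ D, of u d] b[OF f] by (auto simp: mult.assoc)
  qed
  have "\<exists>h\<in>monic_polys t. g * h = g0 * D" if g: "g \<in> B" for g
  proof -
    have "g dvd g0 * b f" if f: "f \<in> A" for f
      using cross f g b(2)[OF f] by (metis dvd_triv_left)
    \<comment> \<open>\<open>g\<close> divides each \<open>f * m = g0 * b f\<close>, hence their
      gcd, which is \<open>g0 * D\<close> up to normalization.\<close>
    then have "g dvd Gcd ((*) g0 ` b ` A)" by (auto intro!: Gcd_greatest)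
    then have "g dvd g0 * D" by (simp add: Gcd_mult D_def)
    then obtain h where h: "g0 * D = g * h" ..
    have "g \<in> monic_polys n" using g B by auto
    then show ?thesis using monic_polys_factor(2)[of g h "n + t" n] K h by auto
  qed
  then show ?thesis using that[of t "g0 * D"] cof f0 K by blast
qed

section \<open>Recognizing the three possible families\<close>

lemma inj_on_cofactor:
  fixes a :: "'b \<Rightarrow> 'c::idom"
  assumes "\<And>x. x \<in> A \<Longrightarrow> a x * w x = c" "inj_on a A" "c \<noteq> 0"
  shows "inj_on w A"
  using assms unfolding inj_on_def by (metis mult_cancel_right mult_eq_0_iff)

text \<open>The multiples of \<open>e\<close> also number q^(n-l), so the inclusion is an
  equality.\<close>

lemma trivial_familyI:
  fixes F :: "'a::{field_gcd, finite} poly set"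
  assumes "F \<subseteq> monic_polys n" "card F = CARD('a) ^ (n - l)" "l \<le> n"
    "e \<in> monic_polys l" "\<And>f. f \<in> F \<Longrightarrow> e dvd f"
  shows "trivial_family n l F"
proof -
  have "F = {f \<in> monic_polys n. e dvd f}"
    using assms by (intro card_subset_eq) (auto simp: card_monic_multiples)
  then show ?thesis using assms(4) unfolding trivial_family_def by blast
qed

text \<open>The map taking f to K/f is injective into the monic polynomials of degree
  \<open>d\<close>, and onto by counting. So all of them divide \<open>K\<close>, and
  \<open>K\<close> is a multiple of \<open>H_poly d\<close>; primarity makes the remaining factor
  1.\<close>

lemma F_familyI:
  fixes F :: "'a::{field_gcd, finite} poly set"
  assumes F: "F \<subseteq> monic_polys n" "card F = CARD('a) ^ d" "primary F"
    and K: "K \<in> monic_polys (n + d)" and co: "\<And>f. f \<in> F \<Longrightarrow> \<exists>h\<in>monic_polys d. f * h = K"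
  shows "F = F_family d"
proof -
  note K0 = monic_polysD(3)[OF K]
  obtain w where w: "\<And>f. f \<in> F \<Longrightarrow> w f \<in> monic_polys d" "\<And>f. f \<in> F \<Longrightarrow> f * w f = K"
    using co by metis
  have "inj_on w F" using inj_on_cofactor[of F "\<lambda>f. f" w K] w(2) K0 by simp
  then have "card (w ` F) = card (monic_polys d :: 'a poly set)"
    by (simp add: card_image F card_monic_polys)
  moreover have "w ` F \<subseteq> monic_polys d" using w(1) by auto
  ultimately have img: "w ` F = monic_polys d" by (simp add: card_subset_eq)
  have div: "h dvd K" if "h \<in> monic_polys d" for h
    using that w(2) img by (metis dvd_triv_right imageE)
  have "p dvd K" if "p \<noteq> 0" "degree p = d" for p
  proof -
    have "normalize p \<in> monic_polys (degree (normalize p))"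
      using that by (intro monic_polys_normalize) auto
    then show ?thesis using div[of "normalize p"] that by (simp add: degree_normalize)
  qed
  then have "H_poly d dvd K" unfolding H_poly_def by (auto intro: Lcm_least)
  then obtain k where k: "K = H_poly d * k" ..
  have H0: "H_poly d \<noteq> (0 :: 'a poly)" using k K0 by auto
  have Hmon: "(H_poly d :: 'a poly) \<in> monic_polys (degree (H_poly d :: 'a poly))"
    by (intro monic_polys_normalize H0) (simp add: H_poly_def)
  \<comment> \<open>\<open>w f\<close> divides \<open>H_poly d\<close>, so cancelling it from
    \<open>f * w f = H_poly d * k\<close> leaves a multiple of \<open>k\<close>.\<close>
  have "k dvd f" if f: "f \<in> F" for f
  proof -
    have "w f dvd H_poly d"
      using w(1)[OF f] unfolding H_poly_def by (intro dvd_Lcm) (auto dest: monic_polysD)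
    then obtain c where "H_poly d = w f * c" ..
    then have "w f * f = w f * (c * k)" using w(2)[OF f] k by (simp add: ac_simps)
    then show ?thesis using monic_polysD(3)[OF w(1)[OF f]] by simp
  qed
  then have "is_unit k" using F(3) unfolding primary_def by blast
  moreover have "k \<noteq> 0" using k K0 by auto
  ultimately have "degree k = 0" by (simp add: is_unit_iff_degree)
  moreover have "lead_coeff k = 1"
    using monic_polysD(1)[OF K] monic_polysD(1)[OF Hmon] by (simp add: k lead_coeff_mult)
  ultimately have "k \<in> monic_polys 0" by (intro monic_polysI)
  then have HK: "H_poly d = K" using k by (simp add: monic_polys_0)
  have "f = K div w f" if "f \<in> F" for f
    using w(2)[OF that] monic_polysD(3)[OF w(1)[OF that]] by (metis nonzero_mult_div_cancel_right)
  then have "F = (\<lambda>h. K div h) ` w ` F" by (force simp: image_image)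
  then show ?thesis unfolding img F_family_def HK by auto
qed

text \<open>With \<open>x = q ^ s\<close> and \<open>y = q ^ t\<close> the hypothesis reads
  \<open>(x - 1) * (y - 1) \<le> 1\<close>.\<close>

lemma power_add_le_sum_powers:
  fixes q s t :: nat
  assumes "2 \<le> q" "0 < s" "0 < t" "q ^ (s + t) \<le> q ^ s + q ^ t"
  shows "q = 2" "s = 1" "t = 1"
proof -
  have ge: "q \<le> q ^ s" "q \<le> q ^ t" using assms by (auto intro: self_le_power)
  define x y where "x = int (q ^ s) - 1" and "y = int (q ^ t) - 1"
  have "2 \<le> int (q ^ s)" "2 \<le> int (q ^ t)" using ge assms(1) by linarith+
  then have xy: "1 \<le> x" "1 \<le> y" unfolding x_def y_def by linarith+
  have "int (q ^ s) * int (q ^ t) \<le> int (q ^ s) + int (q ^ t)"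
    using assms(4) by (metis of_nat_add of_nat_le_iff of_nat_mult power_add)
  then have "x * y \<le> 1" by (simp add: x_def y_def algebra_simps)
  then have "x = 1" "y = 1"
    using xy mult_left_mono[of 1 y x] mult_right_mono[of 1 x y] by linarith+
  then have two: "q ^ s = 2" "q ^ t = 2" unfolding x_def y_def by linarith+
  then show q: "q = 2" using ge assms(1) by simp
  then have "2 ^ s = (2::nat) ^ 1" "2 ^ t = (2::nat) ^ 1" using two by auto
  then show "s = 1" "t = 1" by (metis one_less_numeral_iff power_inject_exp semiring_norm(76))+
qed

lemma card_2_field:
  assumes "CARD('a::{field_gcd, finite}) = 2"
  shows "(UNIV :: 'a set) = {0, 1}" "(1 :: 'a) + 1 = 0"
proof -
  show U: "(UNIV :: 'a set) = {0, 1}"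
    using assms by (intro card_subset_eq[symmetric]) auto
  have "(1 :: 'a) + 1 \<in> {0, 1}" using U by blast
  then show "(1 :: 'a) + 1 = 0" by (metis add_cancel_left_left insertE singletonD zero_neq_one)
qed

text \<open>A prime quadratic has no root: its value at 0 forces the constant coefficient to be 1,
  and then its value at 1 forces the middle one to be 1.\<close>

lemma prime_degree_2_card_2:
  fixes m :: "'a::{field_gcd, finite} poly"
  assumes "CARD('a) = 2" "prime m" "degree m = 2"
  shows "m = [:1, 1, 1:]"
proof -
  note U = card_2_field[OF assms(1)]
  have "m \<in> monic_polys (Suc 1)"
    using prime_monic_polys(1)[OF assms(2)] by (simp add: assms(3) numeral_2_eq_2)
  then obtain a b where m: "m = [:a, b, 1:]" unfolding monic_polys_Suc monic_polys_1 by auto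
  have "a \<in> {0, 1}" "b \<in> {0, 1}" using U by blast+
  moreover have "\<not> [:c, 1:] dvd m" for c
  proof
    assume "[:c, 1:] dvd m"
    then obtain r where r: "m = [:c, 1:] * r" ..
    then have "is_unit [:c, 1:] \<or> is_unit r"
      using assms(2) prime_elem_imp_irreducible irreducibleD by blast
    moreover have "r \<noteq> 0" using r assms(3) by auto
    moreover from this have "degree m = degree [:c, 1:] + degree r"
      unfolding r by (intro degree_mult_eq) auto
    ultimately show False using assms(3) by (auto simp: is_unit_iff_degree)
  qed
  then have "poly m c \<noteq> 0" for c
    using poly_eq_0_iff_dvd[of m "- c"] poly_eq_0_iff_dvd[of m c] by (metis minus_minus)
  then have "poly m 0 \<noteq> 0" "poly m 1 \<noteq> 0" by auto
  ultimately show ?thesis using U(2) m by auto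
qed

text \<open>The cofactors of the two members of \<open>A\<close>, and likewise of \<open>B\<close>,
  run through both linear polynomials \<open>x\<close> and \<open>x + 1\<close>. This determines all
  four members up to a common factor \<open>k\<close>, which primarity makes 1.\<close>

lemma exceptional_familyI:
  fixes F :: "'a::{field_gcd, finite} poly set"
  assumes q: "CARD('a) = 2" and m: "prime m" "degree m = 2"
    and prim: "primary F" and F: "F = A \<union> B" "F \<subseteq> monic_polys n" "card A = 2" "card B = 2"
    and K: "K \<noteq> 0"
    and A: "\<And>f. f \<in> A \<Longrightarrow> \<exists>u\<in>monic_polys 1. f * m = K * u"
    and B: "\<And>g. g \<in> B \<Longrightarrow> \<exists>h\<in>monic_polys 1. g * h = K"
  shows "n = 3" "F = exceptional_family"
proof -
  note U = card_2_field[OF q]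
  define x :: "'a poly" where "x = [:0, 1:]"
  have M1: "monic_polys 1 = {x, x + 1}" unfolding monic_polys_1 U(1) by (auto simp: x_def one_pCons)
  have cM1: "card (monic_polys 1 :: 'a poly set) = 2"
    using card_monic_polys[where 'a = 'a, of 1] q by simp
  have mx: "m = x ^ 2 + x + 1"
    using prime_degree_2_card_2[OF q m] by (simp add: x_def power2_eq_square one_pCons)
  have x0: "x \<noteq> 0" "x + 1 \<noteq> 0" by (auto simp: x_def one_pCons)
  have m0: "m \<noteq> 0" using m by auto
  obtain u where u: "\<And>f. f \<in> A \<Longrightarrow> u f \<in> monic_polys 1" "\<And>f. f \<in> A \<Longrightarrow> f * m = K * u f"
    using A by metis
  obtain w where w: "\<And>g. g \<in> B \<Longrightarrow> w g \<in> monic_polys 1" "\<And>g. g \<in> B \<Longrightarrow> g * w g = K"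
    using B by metis
  have "inj_on u A" using u(2) m0 unfolding inj_on_def by (metis mult_cancel_right)
  then have uA: "u ` A = {x, x + 1}"
    using u(1) M1 cM1 F(3) by (metis card_image card_subset_eq finite_monic_polys image_subsetI)
  have "inj_on w B" using inj_on_cofactor[of B "\<lambda>f. f" w K] w(2) K by simp
  then have wB: "w ` B = {x, x + 1}"
    using w(1) M1 cM1 F(4) by (metis card_image card_subset_eq finite_monic_polys image_subsetI)
  obtain f1 f2 g1 g2 where f: "f1 \<in> A" "f2 \<in> A" "u f1 = x" "u f2 = x + 1"
    and g: "g1 \<in> B" "g2 \<in> B" "w g1 = x" "w g2 = x + 1"
  proof -
    have "x \<in> u ` A" "x + 1 \<in> u ` A" "x \<in> w ` B" "x + 1 \<in> w ` B" using uA wB by simp_all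
    then show thesis using that by auto
  qed
  have "A = {f1, f2}" using f F(3) x0
    by (intro card_subset_eq[symmetric]) (auto simp: card_insert_if intro: card_ge_0_finite)
  moreover have "B = {g1, g2}" using g F(4) x0
    by (intro card_subset_eq[symmetric]) (auto simp: card_insert_if intro: card_ge_0_finite)
  ultimately have F4: "F = {f1, f2, g1, g2}" using F(1) by auto
  have not_dvd: "\<not> m dvd x"
    using dvd_imp_degree_le[of m x] x0 m(2) by (auto simp: x_def)
  have g1: "g1 * x = K" and g2: "g2 * (x + 1) = K"
    and f1: "f1 * m = K * x" and f2: "f2 * m = K * (x + 1)"
    using f g u(2) w(2) by metis+
  \<comment> \<open>The prime \<open>m\<close> of degree 2 does not divide \<open>x\<close>, so it
    passes from \<open>K * x\<close> to \<open>K = g1 * x\<close> and then to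
    \<open>g1\<close>.\<close>
  have "m dvd K * x" using f1 by (metis dvd_triv_right)
  then have "m dvd K" using not_dvd m(1) by (simp add: prime_dvd_mult_iff)
  then have "m dvd g1" using not_dvd m(1) g1 by (metis prime_dvd_mult_iff)
  then obtain c where c: "g1 = m * c" ..
  have "g2 * (x + 1) = (x * x + x + 1) * c * x"
    using g1 g2 c mx by (simp add: power2_eq_square)
  \<comment> \<open>This uses the Bezout identity (x+1)(x^2+1) - x(x^2+x+1) = 1, multiplied by
    \<open>c\<close>.\<close>
  then have "c = (x + 1) * ((x * x + 1) * c - g2)" by (simp add: algebra_simps)
  then have "x + 1 dvd c" by (rule dvdI)
  then obtain k where k: "c = (x + 1) * k" ..
  have G1: "g1 = m * (x + 1) * k" using c k by (simp add: ac_simps)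
  have KK: "K = m * (x + 1) * x * k" using G1 g1 by (simp add: ac_simps)
  have G2: "g2 = m * x * k"
  proof -
    have "g2 * (x + 1) = m * x * k * (x + 1)" using g2 unfolding KK by (simp only: ac_simps)
    then show ?thesis using x0(2) mult_right_cancel by blast
  qed
  have F1: "f1 = x ^ 2 * (x + 1) * k"
  proof -
    have "f1 * m = (x ^ 2 * (x + 1) * k) * m"
      using f1 unfolding KK by (simp add: power2_eq_square ac_simps)
    then show ?thesis using m0 by simp
  qed
  have F2: "f2 = x * (x + 1) ^ 2 * k"
  proof -
    have "f2 * m = (x * (x + 1) ^ 2 * k) * m"
      using f2 unfolding KK by (simp add: power2_eq_square ac_simps)
    then show ?thesis using m0 by simp
  qed
  have "k dvd h" if "h \<in> F" for h using that F4 F1 F2 G1 G2 by auto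
  then have "is_unit k" using prim unfolding primary_def by blast
  moreover have "k \<noteq> 0" using KK K by auto
  ultimately have degk: "degree k = 0" by (simp add: is_unit_iff_degree)
  have g2n: "g2 \<in> monic_polys n" using F F4 by auto
  have "m * x \<in> monic_polys (2 + 1)"
    using prime_monic_polys(1)[OF m(1)] m(2) M1 by (intro monic_polys_mult) auto
  then have mx3: "m * x \<in> monic_polys 3" by simp
  have k3: "k \<in> monic_polys (n - 3)" "3 \<le> n"
    using monic_polys_factor[OF _ mx3, of k n] g2n G2 by auto
  then show n: "n = 3" using degk monic_polysD(2)[OF k3(1)] by simp
  then have "k = 1" using k3 by (simp add: monic_polys_0)
  then show "F = exceptional_family"
    unfolding F4 F1 F2 G1 G2 exceptional_family_def Let_def mx x_def[symmetric]
    by (simp add: mult.commute insert_commute)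
qed

section \<open>Classification of the extremal families\<close>

theorem theorem4:
  fixes q n l :: nat
    and F :: "'a :: {field_gcd, finite} poly set"
  assumes "q = CARD('a)"
    and "l \<le> n"
    and "F \<subseteq> monic_polys n"
    and "intersecting l F"
    and "card F = q ^ (n - l)"
    and "primary F"
    and "\<not> trivial_family n l F"
  shows "(q = 2 \<and> l = 1 \<and> n = 3 \<and> F = exceptional_family) \<or>
         (n - l > 0 \<and> F = F_family (n - l))"
proof -
  define d where "d = n - l"
  have cardF: "card F = CARD('a) ^ d" using assms(1,5) by (simp add: d_def)
  have finF: "finite F" using assms(3) finite_monic_polys finite_subset by blast
  have q2: "2 \<le> q" using assms(1) CARD_field_ge_2[where 'a = 'a] by simp
  \<comment> \<open>For \<open>d = 0\<close> the family has a single member, which itself serves as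
    the fixed divisor of a trivial family.\<close>
  have d0: "0 < d"
  proof (rule ccontr)
    assume "\<not> 0 < d"
    then have "l = n" "card F = 1" using assms(2) cardF by (auto simp: d_def)
    then obtain f where f: "F = {f}" by (auto simp: card_1_singleton_iff)
    have "trivial_family n l F"
      by (rule trivial_familyI[of _ _ _ f]) (use assms cardF f \<open>l = n\<close> d_def in auto)
    then show False using assms(7) by simp
  qed
  obtain m :: "'a poly" where m: "prime m" "degree m = d" using exists_prime_of_degree[OF d0] by blast
  have mm: "m \<in> monic_polys d" using prime_monic_polys(1)[OF m(1)] m(2) by simp
  have m0: "m \<noteq> 0" using m(1) by auto
  \<comment> \<open>As \<open>m\<close> does not divide \<open>b\<close>, the multiplicity of
    \<open>f\<close> is that of \<open>e\<close>, and \<open>g = e * m\<close> has one more: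
    distinct multiplicities always differ by one.\<close>
  have step: "\<exists>e\<in>monic_polys l. \<exists>b\<in>monic_polys d. f = e * b \<and> g = e * m \<and>
      multiplicity m g = Suc (multiplicity m f)"
    if fg: "f \<in> F" "g \<in> F" "multiplicity m f < multiplicity m g" for f g
  proof -
    have "f \<in> monic_polys n" "g \<in> monic_polys n" "l \<le> degree (gcd f g)"
      using fg assms(3,4) by (auto simp: intersecting_def)
    then obtain e b where eb: "e \<in> monic_polys l" "b \<in> monic_polys d" "\<not> m dvd b"
      "f = e * b" "g = e * m"
      using prime_multiplicity_less_decompose[OF m(1) _ assms(2) _ _ _ fg(3)] m(2)
      unfolding d_def by metis
    have "multiplicity m b = 0" using eb(3) by (rule not_dvd_imp_multiplicity_0)
    then have "multiplicity m g = Suc (multiplicity m f)"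
      using eb m(1) m0 monic_polysD(3)[OF eb(1)] monic_polysD(3)[OF eb(2)]
      by (simp add: prime_elem_multiplicity_mult_distrib)
    then show ?thesis using eb by blast
  qed
  obtain f1 g1 where f1: "f1 \<in> F" and g1: "g1 \<in> F" and less: "multiplicity m f1 < multiplicity m g1"
    using exists_multiplicity_less[OF m(1) _ assms(3,4)] m(2) cardF unfolding d_def by blast
  define v where "v = multiplicity m f1"
  have vg1: "multiplicity m g1 = Suc v" using step[OF f1 g1 less] by (auto simp: v_def)
  define A where "A = {f \<in> F. multiplicity m f = v}"
  define B where "B = {f \<in> F. multiplicity m f = Suc v}"
  have "f \<in> A \<union> B" if "f \<in> F" for f
  proof -
    \<comment> \<open>A multiplicity below that of \<open>g1\<close> is exactly one below it, and
      one above that of \<open>f1\<close> is exactly one above it.\<close>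
    have "multiplicity m f \<ge> v"
      using step[OF that g1] vg1 by (cases "multiplicity m f < Suc v") auto
    moreover have "multiplicity m f \<le> Suc v"
      using step[OF f1 that] v_def by (cases "v < multiplicity m f") auto
    ultimately show ?thesis using that by (auto simp: A_def B_def)
  qed
  then have AB: "F = A \<union> B" "A \<inter> B = {}" "f1 \<in> A" "g1 \<in> B"
    using f1 g1 vg1 by (auto simp: A_def B_def v_def)
  have finAB: "finite A" "finite B" using finF AB(1) by auto
  have "\<exists>b\<in>monic_polys d. f * m = g * b" if "f \<in> A" "g \<in> B" for f g
    using step[of f g] that by (force simp: A_def B_def ac_simps)
  then have cross: "\<forall>f\<in>A. \<forall>g\<in>B. \<exists>b\<in>monic_polys d. f * m = g * b" by blast
  have sub: "A \<subseteq> monic_polys n" "A \<noteq> {}" "B \<subseteq> monic_polys n" "B \<noteq> {}"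
    using AB assms(3) by auto
  obtain K t where t: "t \<le> d" and K: "K \<in> monic_polys (n + t)"
    and KA: "\<And>f. f \<in> A \<Longrightarrow> \<exists>u\<in>monic_polys (d - t). f * m = K * u"
    and KB: "\<And>g. g \<in> B \<Longrightarrow> \<exists>h\<in>monic_polys t. g * h = K"
    by (rule common_multiple_of_bipartition[OF sub cross]) (rule that)
  note K0 = monic_polysD(3)[OF K]
  consider "t = 0" | "t = d" | "0 < t" "t < d" using t by linarith
  then show ?thesis
  proof cases
    case 1
    \<comment> \<open>With \<open>t = 0\<close> the cofactor is 1, so \<open>B\<close> contains only
      \<open>K = e * m\<close>. Cancelling \<open>m\<close> in \<open>f * m = K * u\<close> then
      shows that \<open>e\<close> divides the members of \<open>A\<close> too.\<close>
    have gK: "g = K" if "g \<in> B" for g using KB[OF that] 1 by (auto simp: monic_polys_0)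
    obtain e where e: "e \<in> monic_polys l" "g1 = e * m" using step[OF f1 g1 less] by auto
    have "e dvd f" if f: "f \<in> F" for f
    proof (cases "f \<in> B")
      case True
      then show ?thesis using gK AB(4) e(2) by (metis dvd_triv_left)
    next
      case False
      then obtain u where "f * m = K * u" using KA AB(1) f by blast
      then have "f * m = (e * u) * m" using gK[OF AB(4)] e(2) by (simp add: ac_simps)
      then show ?thesis using m0 by simp
    qed
    then have "trivial_family n l F"
      using trivial_familyI[OF assms(3) _ assms(2) e(1)] cardF by (simp add: d_def)
    then show ?thesis using assms(7) by simp
  next
    case 2
    \<comment> \<open>For \<open>f\<close> in \<open>A\<close> the polynomial \<open>u\<close> has
      degree 0, so \<open>f * m = K\<close> and the required cofactor is \<open>m\<close>
      itself.\<close>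
    have "\<exists>h\<in>monic_polys d. f * h = K" if "f \<in> F" for f
      using that KA[of f] KB[of f] AB(1) mm 2 by (auto simp: monic_polys_0)
    then have "F = F_family d"
      using F_familyI[OF assms(3) cardF assms(6)] K 2 by blast
    then show ?thesis using d0 by (simp add: d_def)
  next
    case 3
    obtain u where u: "\<And>f. f \<in> A \<Longrightarrow> u f \<in> monic_polys (d - t)" "\<And>f. f \<in> A \<Longrightarrow> f * m = K * u f"
      using KA by metis
    have "inj_on u A" using u(2) m0 unfolding inj_on_def by (metis mult_cancel_right)
    then have cA: "card A \<le> q ^ (d - t)"
      using card_inj_on_le[of u A "monic_polys (d - t)"] u(1) assms(1)
      by (auto simp: card_monic_polys)
    obtain w where w: "\<And>g. g \<in> B \<Longrightarrow> w g \<in> monic_polys t" "\<And>g. g \<in> B \<Longrightarrow> g * w g = K"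
      using KB by metis
    have "inj_on w B" using inj_on_cofactor[of B "\<lambda>f. f" w K] w(2) K0 by simp
    then have cB: "card B \<le> q ^ t"
      using card_inj_on_le[of w B "monic_polys t"] w(1) assms(1)
      by (auto simp: card_monic_polys)
    have sum: "q ^ d = card A + card B"
      using cardF AB(1,2) finAB assms(1) by (simp add: card_Un_disjoint)
    then have "q ^ ((d - t) + t) \<le> q ^ (d - t) + q ^ t" using cA cB t by simp
    then have q: "q = 2" "d - t = 1" "t = 1"
      using power_add_le_sum_powers[OF q2, of "d - t" t] 3 by auto
    then have d: "d = 2" by simp
    \<comment> \<open>Both cardinalities are at most 2 and they sum to 4.\<close>
    have "card A = 2" "card B = 2" using sum cA cB q d by auto
    then have "n = 3" "F = exceptional_family"
      using exceptional_familyI[of m F A B n K] m d q assms(1,3,6) AB(1) K0 KA KB by auto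
    moreover from this have "l = 1" using d d_def assms(2) by linarith
    ultimately show ?thesis using q by simp
  qed
qed

end
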